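(* There exists a special Lagrangian graph in $\mathbb{C}^{3}$ over $\mathbb{R}^{3}$ that does not graphically split.
   Context: For a function $u:\mathbb{R}^n\to\mathbb{R}$, consider the graph $\{(x,\nabla u(x)):x\in\mathbb{R}^n\}\subset\mathbb{C}^n$ over $\mathbb{R}^n$, where $\mathbb{C}^n$ is identified with $\mathbb{R}^n\times\mathbb{R}^n$ via $x+iy\leftrightarrow(x,y)$. By Harvey and Lawson, such a graph is special Lagrangian and a minimizing surface if and only if $u$ satisfies the special Lagrangian equation $\sum_{i=1}^{n}\arctan\lambda_{i}=\theta$, where $\lambda_1,\dots,\lambda_n$ are the eigenvalues of the Hessian $D^2u$ and $\theta\in\left(-\frac{n}{2}\pi,\frac{n}{2}\pi\right)$ is a constant. The graph is said to split graphically when the function $u$ can be written as the sum of two functions in independent variables. *)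

theory Defs
  imports "HOL-Analysis.Analysis"
begin

text \<open>
  On a Euclidean domain, \<open>Ck k f\<close> is equivalent to continuity of all partial derivatives
  of order at most \<open>k\<close>.
\<close>

primrec Ck :: "nat \<Rightarrow> ('a::euclidean_space \<Rightarrow> 'b::real_normed_vector) \<Rightarrow> bool" where
  "Ck 0 f \<longleftrightarrow> continuous_on UNIV f"
| "Ck (Suc k) f \<longleftrightarrow>
     (\<exists>f'. (\<forall>x. (f has_derivative f' x) (at x)) \<and> (\<forall>v. Ck k (\<lambda>x. f' x v)))"

definition smooth :: "('a::euclidean_space \<Rightarrow> 'b::real_normed_vector) \<Rightarrow> bool" where
  "smooth f \<longleftrightarrow> (\<forall>k. Ck k f)"

definition gradient :: "(real^'n \<Rightarrow> real) \<Rightarrow> real^'n \<Rightarrow> real^'n" where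
  "gradient u x = (\<chi> i. frechet_derivative u (at x) (axis i 1))"

definition hessian :: "(real^'n \<Rightarrow> real) \<Rightarrow> real^'n \<Rightarrow> real^'n^'n" where
  "hessian u x = jacobian (gradient u) (at x)"

text \<open>The family \<open>l\<close> lists the eigenvalues of \<open>A\<close> with algebraic multiplicity.\<close>

definition eigenvalue_family :: "real^'n^'n \<Rightarrow> ('n \<Rightarrow> real) \<Rightarrow> bool" where
  "eigenvalue_family A l \<longleftrightarrow> (\<forall>t. det (mat t - A) = (\<Prod>i\<in>UNIV. t - l i))"

definition special_lagrangian_equation :: "real \<Rightarrow> (real^'n \<Rightarrow> real) \<Rightarrow> bool" where
  "special_lagrangian_equation \<theta> u \<longleftrightarrow>
     (\<forall>x. \<exists>l. eigenvalue_family (hessian u x) l \<and> (\<Sum>i\<in>UNIV. arctan (l i)) = \<theta>)"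

definition gradient_graph :: "(real^'n \<Rightarrow> real) \<Rightarrow> real^'n \<Rightarrow> complex^'n" where
  "gradient_graph u x = (\<chi> i. Complex (x $ i) (gradient u x $ i))"

text \<open>The standard symplectic form \<open>\<Sum>i. dx\<^sub>i \<and> dy\<^sub>i\<close> on complex \<open>n\<close>-space.\<close>

definition symplectic_form :: "complex^'n \<Rightarrow> complex^'n \<Rightarrow> real" where
  "symplectic_form z w = (\<Sum>i\<in>UNIV. Im (cnj (z $ i) * w $ i))"

text \<open>
  A Lagrangian immersion calibrated by the real part of
  \<open>exp (- \<i> \<theta>) dz\<^sub>1 \<and> \<dots> \<and> dz\<^sub>n\<close>: evaluated on the coordinate frame, this form agrees with the
  induced volume, the square root of the Gram determinant.
\<close>

definition special_lagrangian_immersion :: "real \<Rightarrow> (real^'n \<Rightarrow> complex^'n) \<Rightarrow> bool" where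
  "special_lagrangian_immersion \<theta> F \<longleftrightarrow> smooth F \<and>
     (\<forall>x. let D = frechet_derivative F (at x) in
        inj D \<and>
        (\<forall>v w. symplectic_form (D v) (D w) = 0) \<and>
        Re (cis (- \<theta>) * det (\<chi> i j. D (axis j 1) $ i))
          = sqrt (det (\<chi> i j. D (axis i 1) \<bullet> D (axis j 1))))"

text \<open>
  Independent variables are linear coordinates on the two factors of an arbitrary, not
  necessarily orthogonal, nontrivial direct sum decomposition. Splittings along the standard
  coordinates alone would be too few: every quadratic polynomial splits after a rotation.
\<close>

definition graphically_splits :: "(real^'n \<Rightarrow> real) \<Rightarrow> bool" where
  "graphically_splits u \<longleftrightarrow>
     (\<exists>V W. subspace V \<and> subspace W \<and> V \<noteq> {0} \<and> W \<noteq> {0} \<and>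
        V \<inter> W = {0} \<and> {v + w |v w. v \<in> V \<and> w \<in> W} = UNIV \<and>
        (\<exists>f g. \<forall>v\<in>V. \<forall>w\<in>W. u (v + w) = f v + g w))"

end

theory Submission
  imports Defs
begin

text \<open>
  The example is Warren's nonpolynomial entire solution
  \<open>u(x, y, t) = (x\<^sup>2 + y\<^sup>2 - 1) exp t + exp (-t) / 4\<close> of \<open>\<sigma>\<^sub>2(D\<^sup>2u) = 1\<close>. The real and imaginary
  parts of \<open>\<Prod>i. 1 + \<i> \<lambda>\<^sub>i\<close> are \<open>1 - \<sigma>\<^sub>2 = 0\<close> and \<open>\<sigma>\<^sub>1 - \<sigma>\<^sub>3 > 0\<close>, so the phase is \<open>\<pi> / 2\<close>. One
  eigenvalue is \<open>2 exp t\<close>, and the other two have product less than \<open>1\<close>, so that the arctangent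
  addition formula applies to them without a jump by \<open>\<pi>\<close>. If \<open>u\<close> split along \<open>V \<oplus> W\<close>, the mixed
  second differences of \<open>u\<close> with steps in \<open>V\<close> and \<open>W\<close> would vanish; their leading coefficient in \<open>x\<close>
  and \<open>y\<close> is a multiple of \<open>(exp v\<^sub>3 - 1) (exp w\<^sub>3 - 1)\<close>, which forces one summand to be trivial.
\<close>

section \<open>Calculus of derivatives and of \<open>Ck\<close> functions\<close>

lemma has_derivative_vec_lambda:
  fixes f :: "'a::real_normed_vector \<Rightarrow> 'n::finite \<Rightarrow> 'b::euclidean_space"
  assumes "\<And>i. ((\<lambda>x. f x i) has_derivative (\<lambda>v. f' v i)) (at x within S)"
  shows "((\<lambda>x. \<chi> i. f x i) has_derivative (\<lambda>v. \<chi> i. f' v i)) (at x within S)"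
  unfolding has_derivative_componentwise_within[where f = "\<lambda>x. \<chi> i. f x i"]
  by (auto simp: Basis_vec_def inner_axis intro!: has_derivative_inner_left assms)

lemma Ck_SucI:
  assumes "\<And>x. (f has_derivative f' x) (at x)" "\<And>v. Ck k (\<lambda>x. f' x v)"
  shows "Ck (Suc k) f"
  using assms by auto

text \<open>The product and chain rules bring back undifferentiated factors; \<open>Ck_mult\<close>
  and \<open>Ck_exp\<close> use this to have them at the lower order of the induction
  hypothesis.\<close>

lemma Ck_SucD: "Ck (Suc k) f \<Longrightarrow> Ck k f"
proof (induction k arbitrary: f)
  case 0
  then show ?case
    by (auto simp: continuous_on_eq_continuous_within intro: has_derivative_continuous)
next
  case (Suc k)
  from Suc.prems obtain f' where f': "\<And>x. (f has_derivative f' x) (at x)"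
    "\<And>v. Ck (Suc k) (\<lambda>x. f' x v)"
    unfolding Ck.simps(2)[of "Suc k"] by blast
  then show ?case
    using Suc.IH by (intro Ck_SucI) auto
qed

lemma Ck_const: "Ck k (\<lambda>x. c)"
proof (induction k arbitrary: c)
  case (Suc k)
  show ?case by (rule Ck_SucI[where f' = "\<lambda>x v. 0"]) (auto intro: Suc.IH)
qed simp

lemma Ck_bounded_linear:
  assumes "bounded_linear L" "Ck k f"
  shows "Ck k (\<lambda>x. L (f x))"
  using assms(2)
proof (induction k arbitrary: f)
  case 0
  then show ?case
    using bounded_linear.continuous_on[OF assms(1)] by auto
next
  case (Suc k)
  from Suc.prems obtain f' where f': "\<And>x. (f has_derivative f' x) (at x)"
    "\<And>v. Ck k (\<lambda>x. f' x v)" by auto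
  show ?case
    by (rule Ck_SucI[where f' = "\<lambda>x v. L (f' x v)"])
      (use f' Suc.IH in \<open>auto intro: bounded_linear.has_derivative[OF assms(1)]\<close>)
qed

lemma Ck_ident: "Ck k (\<lambda>x. x)"
  by (cases k) (auto intro!: Ck_const exI[where x = "\<lambda>x v. v"])

lemma Ck_add:
  assumes "Ck k f" "Ck k g"
  shows "Ck k (\<lambda>x. f x + g x)"
  using assms
proof (induction k arbitrary: f g)
  case 0
  then show ?case by (auto intro: continuous_intros)
next
  case (Suc k)
  from Suc.prems obtain f' g' where
    "\<And>x. (f has_derivative f' x) (at x)" "\<And>v. Ck k (\<lambda>x. f' x v)"
    "\<And>x. (g has_derivative g' x) (at x)" "\<And>v. Ck k (\<lambda>x. g' x v)"
    unfolding Ck.simps(2) by blast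
  then show ?case
    using Suc.IH by (intro Ck_SucI[where f' = "\<lambda>x v. f' x v + g' x v"])
      (auto intro: has_derivative_add)
qed

lemma Ck_mult:
  fixes f g :: "'a::euclidean_space \<Rightarrow> real"
  assumes "Ck k f" "Ck k g"
  shows "Ck k (\<lambda>x. f x * g x)"
  using assms
proof (induction k arbitrary: f g)
  case 0
  then show ?case by (auto intro: continuous_intros)
next
  case (Suc k)
  from Suc.prems obtain f' g' where *:
    "\<And>x. (f has_derivative f' x) (at x)" "\<And>v. Ck k (\<lambda>x. f' x v)"
    "\<And>x. (g has_derivative g' x) (at x)" "\<And>v. Ck k (\<lambda>x. g' x v)"
    unfolding Ck.simps(2) by blast
  have "Ck k f" "Ck k g"
    using Suc.prems by (blast dest: Ck_SucD)+
  with * show ?case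
    using Suc.IH by (intro Ck_SucI[where f' = "\<lambda>x v. f x * g' x v + f' x v * g x"])
      (auto intro!: has_derivative_mult Ck_add)
qed

lemma Ck_exp:
  fixes f :: "'a::euclidean_space \<Rightarrow> real"
  assumes "Ck k f"
  shows "Ck k (\<lambda>x. exp (f x))"
  using assms
proof (induction k arbitrary: f)
  case 0
  then show ?case by (auto intro: continuous_intros)
next
  case (Suc k)
  from Suc.prems obtain f' where *:
    "\<And>x. (f has_derivative f' x) (at x)" "\<And>v. Ck k (\<lambda>x. f' x v)"
    by auto
  have "Ck k f"
    using Suc.prems by (rule Ck_SucD)
  with * show ?case
    using Suc.IH by (intro Ck_SucI[where f' = "\<lambda>x v. exp (f x) * f' x v"])
      (auto intro!: Ck_mult derivative_eq_intros)
qed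

lemma Ck_vec_lambda:
  fixes f :: "'a::euclidean_space \<Rightarrow> 'n::finite \<Rightarrow> 'b::euclidean_space"
  assumes "\<And>i. Ck k (\<lambda>x. f x i)"
  shows "Ck k (\<lambda>x. \<chi> i. f x i)"
  using assms
proof (induction k arbitrary: f)
  case 0
  then show ?case by (auto intro: continuous_intros)
next
  case (Suc k)
  then have "\<forall>i. \<exists>f'. (\<forall>x. ((\<lambda>x. f x i) has_derivative f' x) (at x)) \<and>
      (\<forall>v. Ck k (\<lambda>x. f' x v))"
    by simp
  then obtain f' where
    "\<And>i x. ((\<lambda>x. f x i) has_derivative f' i x) (at x)" "\<And>i v. Ck k (\<lambda>x. f' i x v)"
    by metis
  then show ?case
    using Suc.IH by (intro Ck_SucI[where f' = "\<lambda>x v. \<chi> i. f' i x v"])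
      (auto intro!: has_derivative_vec_lambda)
qed

lemma Ck_nth: "Ck k (\<lambda>x::real^'n. x $ i)"
  by (rule Ck_bounded_linear[OF bounded_linear_vec_nth Ck_ident])

lemma Ck_Complex:
  assumes "Ck k f" "Ck k g"
  shows "Ck k (\<lambda>x. Complex (f x) (g x))"
  unfolding Complex_eq
  by (intro Ck_add Ck_bounded_linear[OF bounded_linear_of_real]
      Ck_bounded_linear[OF bounded_linear_mult_right] assms)

section \<open>Differential of the graph map, and sums of arctangents\<close>

lemma frechet_derivative_gradient_graph:
  assumes "(gradient u has_derivative (\<lambda>h. A *v h)) (at x)"
  shows "frechet_derivative (gradient_graph u) (at x) =
    (\<lambda>h. \<chi> i. Complex (h $ i) ((A *v h) $ i))"
proof (rule frechet_derivative_at[symmetric])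
  have "((\<lambda>x. gradient u x $ i) has_derivative (\<lambda>h. (A *v h) $ i)) (at x)" for i
    by (rule bounded_linear.has_derivative[OF bounded_linear_vec_nth assms])
  then show "(gradient_graph u has_derivative
      (\<lambda>h. \<chi> i. Complex (h $ i) ((A *v h) $ i))) (at x)"
    unfolding gradient_graph_def[abs_def] Complex_eq
    by (intro has_derivative_vec_lambda has_derivative_add has_derivative_mult_right
        has_derivative_of_real bounded_linear_imp_has_derivative[OF bounded_linear_vec_nth])
qed

text \<open>The bound on \<open>p * q\<close> keeps the sum strictly between -pi/2 and pi/2, where
  the tangent addition formula can be inverted.\<close>

lemma arctan_add_arctan:
  assumes "p * q < 1"
  shows "arctan p + arctan q = arctan ((p + q) / (1 - p * q))"
proof (rule arctan_unique[symmetric])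
  have upper: "arctan p + arctan q < pi / 2" if "p * q < 1" for p q :: real
  proof (cases "p > 0")
    case True
    \<comment> \<open>The arctangent of \<open>1 / p\<close> is the complement of
      \<open>arctan p\<close>.\<close>
    then have "arctan q < arctan (1 / p)"
      using that by (simp add: arctan_less_iff field_simps)
    then show ?thesis
      using True arctan_inverse[of p] by (simp add: inverse_eq_divide)
  next
    case False
    then have "arctan p \<le> 0" by simp
    then show ?thesis
      using arctan_ubound[of q] by linarith
  qed
  show 1: "arctan p + arctan q < pi / 2"
    using assms by (rule upper)
  show 2: "- (pi / 2) < arctan p + arctan q"
    using upper[of "- p" "- q"] assms by (simp add: arctan_minus)
  have "cos (arctan p + arctan q) \<noteq> 0"
    using cos_gt_zero_pi[OF 2 1] by simp
  then show "tan (arctan p + arctan q) = (p + q) / (1 - p * q)"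
    using tan_add[of "arctan p" "arctan q"] by (simp add: tan_arctan)
qed

text \<open>The last hypothesis is \<sigma>2 = 1 for the triple a, p, q. It turns the tangent of
  \<open>arctan p + arctan q\<close> into \<open>1 / a\<close>, and \<open>arctan (1 / a)\<close>
  complements \<open>arctan a\<close>.\<close>

lemma arctan_sum_eq_pi_half:
  assumes "a > 0" "p * q < 1" "a * (p + q) + p * q = 1"
  shows "arctan a + arctan p + arctan q = pi / 2"
proof -
  have "(p + q) / (1 - p * q) = 1 / a"
    using assms by (simp add: field_simps)
  then show ?thesis
    using arctan_add_arctan[OF assms(2)] assms(1) arctan_inverse[of a]
    by (simp add: inverse_eq_divide)
qed

section \<open>Warren's solution and its derivatives\<close>

definition warren :: "real^3 \<Rightarrow> real" where
  "warren x = ((x $ 1)^2 + (x $ 2)^2 - 1) * exp (x $ 3) + exp (- x $ 3) / 4"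

definition warren_hessian :: "real^3 \<Rightarrow> real^3^3" where
  "warren_hessian x = vector
    [vector [2 * exp (x $ 3), 0, 2 * x $ 1 * exp (x $ 3)],
     vector [0, 2 * exp (x $ 3), 2 * x $ 2 * exp (x $ 3)],
     vector [2 * x $ 1 * exp (x $ 3), 2 * x $ 2 * exp (x $ 3), warren x]]"
  \<comment> \<open>the second derivative in \<open>t\<close> happens to be the potential itself\<close>

lemma gradient_warren:
  "gradient warren x = vector [2 * x $ 1 * exp (x $ 3), 2 * x $ 2 * exp (x $ 3),
    ((x $ 1)^2 + (x $ 2)^2 - 1) * exp (x $ 3) - exp (- x $ 3) / 4]"
proof -
  have "(warren has_derivative (\<lambda>h. 2 * x $ 1 * exp (x $ 3) * h $ 1 + 2 * x $ 2 * exp (x $ 3) * h $ 2 +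
      (((x $ 1)^2 + (x $ 2)^2 - 1) * exp (x $ 3) - exp (- x $ 3) / 4) * h $ 3)) (at x)"
    unfolding warren_def[abs_def]
    by (auto intro!: derivative_eq_intros bounded_linear.has_derivative[OF bounded_linear_vec_nth]
        simp: fun_eq_iff algebra_simps)
  from frechet_derivative_at[OF this, symmetric] show ?thesis
    by (simp add: gradient_def vec_eq_iff forall_3 axis_def)
qed

lemma gradient_warren_has_derivative:
  "(gradient warren has_derivative (\<lambda>h. warren_hessian x *v h)) (at x)"
proof -
  have "\<forall>i. ((\<lambda>x. gradient warren x $ i) has_derivative (\<lambda>h. (warren_hessian x *v h) $ i)) (at x)"
    unfolding gradient_warren forall_3 warren_hessian_def matrix_vector_mult_def warren_def sum_3
    by (auto intro!: derivative_eq_intros bounded_linear.has_derivative[OF bounded_linear_vec_nth]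
        simp: fun_eq_iff algebra_simps)
  then show ?thesis
    using has_derivative_vec_lambda[of "\<lambda>x i. gradient warren x $ i" "\<lambda>h i. (warren_hessian x *v h) $ i"]
    by simp
qed

lemma hessian_warren: "hessian warren x = warren_hessian x"
  unfolding hessian_def jacobian_def frechet_derivative_at[OF gradient_warren_has_derivative, symmetric]
  by simp

lemma smooth_warren: "smooth warren"
  unfolding smooth_def warren_def[abs_def] power2_eq_square diff_conv_add_uminus divide_inverse
  by (intro allI Ck_add Ck_mult Ck_exp Ck_nth Ck_const
      Ck_bounded_linear[OF bounded_linear_minus[OF bounded_linear_ident]])

lemma smooth_gradient_graph_warren: "smooth (gradient_graph warren)"
proof -
  have "Ck k (\<lambda>x. gradient warren x $ i)" for k i
  proof -
    have "\<forall>i. Ck k (\<lambda>x. gradient warren x $ i)"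
      unfolding gradient_warren forall_3 vector_3 power2_eq_square diff_conv_add_uminus divide_inverse
      by (intro conjI Ck_add Ck_mult Ck_exp Ck_nth Ck_const
          Ck_bounded_linear[OF bounded_linear_minus[OF bounded_linear_ident]])
    then show ?thesis ..
  qed
  then show ?thesis
    unfolding smooth_def gradient_graph_def[abs_def]
    by (intro allI Ck_vec_lambda Ck_Complex Ck_nth)
qed

section \<open>Special Lagrangian equation and calibration\<close>

lemma special_lagrangian_equation_warren: "special_lagrangian_equation (pi / 2) warren"
  unfolding special_lagrangian_equation_def hessian_warren
proof
  fix x :: "real^3"
  \<comment> \<open>Rotating (x, y) onto an axis decouples the eigenvalue \<open>2 * E\<close> from
    a symmetric 2 by 2 block with diagonal \<open>2 * E\<close>, \<open>warren x\<close> and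
    off-diagonal entry \<open>2 * sqrt r * E\<close>. Its eigenvalues are \<open>p\<close> and
    \<open>q\<close>, and \<open>d^2\<close> is its discriminant.\<close>
  define E where "E = exp (x $ 3)"
  define r where "r = (x $ 1)^2 + (x $ 2)^2"
  define d where "d = sqrt ((2 * E - warren x)^2 + 16 * r * E^2)"
  define p q where "p = (2 * E + warren x + d) / 2" and "q = (2 * E + warren x - d) / 2"
  define l :: "3 \<Rightarrow> real" where "l i = (if i = 1 then 2 * E else if i = 2 then p else q)" for i
  have E: "E > 0" and r: "r \<ge> 0" by (simp_all add: E_def r_def)
  \<comment> \<open>The factor \<open>4 * E\<close> clears the term exp (-t) / 4, leaving a
    polynomial relation.\<close>
  have u: "4 * E * warren x = 4 * (r - 1) * E^2 + 1"
    by (simp add: warren_def E_def r_def exp_minus field_simps power2_eq_square)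
  have "d^2 = (2 * E - warren x)^2 + 16 * r * E^2"
    unfolding d_def using r by (subst real_sqrt_pow2) auto
  then have pq: "p + q = 2 * E + warren x" "p * q = 2 * E * warren x - 4 * r * E^2"
    unfolding p_def q_def by (auto simp: field_simps power2_eq_square)
  have "p * q = 1 / 2 - 2 * E^2 * (1 + r)"
    using pq(2) u by (simp add: algebra_simps)
  then have pq_less: "p * q < 1"
    using mult_nonneg_nonneg[of "2 * E^2" "1 + r"] r zero_le_power2[of E] by linarith
  have "2 * E * (p + q) + p * q = 1"
    unfolding pq using u by (simp add: algebra_simps power2_eq_square)
  then have "(\<Sum>i\<in>UNIV. arctan (l i)) = pi / 2"
    using arctan_sum_eq_pi_half[of "2 * E" p q] E pq_less by (simp add: sum_3 l_def)
  moreover have "eigenvalue_family (warren_hessian x) l"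
    unfolding eigenvalue_family_def
  proof
    fix t
    have "det (mat t - warren_hessian x) = (t - 2 * E) * ((t - 2 * E) * (t - warren x) - 4 * r * E^2)"
      unfolding det_3 warren_hessian_def
      by (simp add: mat_def flip: E_def) (simp add: r_def algebra_simps power2_eq_square)
    also have "\<dots> = (t - 2 * E) * (t * t - (p + q) * t + p * q)"
      unfolding pq by (simp add: algebra_simps)
    also have "\<dots> = (t - 2 * E) * ((t - p) * (t - q))"
      by (simp add: algebra_simps)
    also have "\<dots> = (\<Prod>i\<in>UNIV. t - l i)"
      unfolding UNIV_3 by (simp add: l_def)
    finally show "det (mat t - warren_hessian x) = (\<Prod>i\<in>UNIV. t - l i)" .
  qed
  ultimately show "\<exists>l. eigenvalue_family (warren_hessian x) l \<and> (\<Sum>i\<in>UNIV. arctan (l i)) = pi / 2"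
    by blast
qed

text \<open>The differential is I + i A with A the symmetric Hessian, and det (I + i A) = (1 -
  \<sigma>2) + i (\<sigma>1 - \<sigma>3). The Gram matrix is I + A^2 = (I + i A)(I - i A), so its
  determinant is the squared modulus of that number.\<close>

lemma special_lagrangian_immersion_warren:
  "special_lagrangian_immersion (pi / 2) (gradient_graph warren)"
  unfolding special_lagrangian_immersion_def Let_def
    frechet_derivative_gradient_graph[OF gradient_warren_has_derivative]
proof (intro conjI allI smooth_gradient_graph_warren)
  fix x v w :: "real^3"
  let ?D = "\<lambda>h. \<chi> i. Complex (h $ i) ((warren_hessian x *v h) $ i)"
  show "inj ?D"
    by (auto simp: inj_def vec_eq_iff)
  show "symplectic_form (?D v) (?D w) = 0"
    by (simp add: symplectic_form_def sum_3 warren_hessian_def matrix_vector_mult_def algebra_simps)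
  define E where "E = exp (x $ 3)"
  define a b c where "a = x $ 1" and "b = x $ 2" and "c = warren x"
  have E: "E > 0" by (simp add: E_def)
  have c: "4 * E * c = 4 * (a^2 + b^2 - 1) * E^2 + 1"
    by (simp add: c_def warren_def E_def a_def b_def exp_minus field_simps power2_eq_square)
  have D: "?D (axis j 1) $ i = Complex (if i = j then 1 else 0) (warren_hessian x $ i $ j)" for i j
    by (simp add: axis_def matrix_vector_mult_def if_distrib cong: if_cong)
  \<comment> \<open>This is \<sigma>1 - \<sigma>3; the factor \<open>cis (- (pi / 2))\<close>, that
    is -i, moves it into the real part.\<close>
  define s where "s = 4 * E + c - 4 * E^2 * (c - 2 * E * (a^2 + b^2))"
  have Re_det: "Re (cis (- (pi / 2)) * det (\<chi> i j. ?D (axis j 1) $ i)) = s"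
    unfolding D det_3
    by (simp add: warren_hessian_def flip: E_def a_def b_def c_def)
      (simp add: s_def algebra_simps power2_eq_square)
  have gram: "det (\<chi> i j. ?D (axis i 1) \<bullet> ?D (axis j 1)) =
      s^2 + (1 - (4 * E^2 + 4 * E * c - 4 * E^2 * (a^2 + b^2)))^2"
    unfolding det_3 inner_vec_def D inner_complex_def sum_3
    by (simp add: warren_hessian_def flip: E_def a_def b_def c_def)
      (simp add: s_def algebra_simps power2_eq_square)
  have zero: "1 - (4 * E^2 + 4 * E * c - 4 * E^2 * (a^2 + b^2)) = 0"
    unfolding c by (simp add: algebra_simps)
  \<comment> \<open>The sign fixes the orientation, since \<open>sqrt (s^2)\<close> is the absolute
    value of \<open>s\<close>. Multiplying by \<open>4 * E\<close> lets \<open>c\<close> be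
    eliminated, and only nonnegative terms remain.\<close>
  have s: "s \<ge> 0"
  proof -
    have "4 * E * s = 16 * E^2 + (1 - 4 * E^2) * (4 * E * c) + 32 * E^4 * (a^2 + b^2)"
      by (simp add: s_def algebra_simps power2_eq_square power4_eq_xxxx)
    also have "\<dots> = 1 + 8 * E^2 + 4 * (a^2 + b^2) * E^2 + 16 * E^4 * (1 + a^2 + b^2)"
      unfolding c by (simp add: algebra_simps power2_eq_square power4_eq_xxxx)
    also have "\<dots> \<ge> 0" by simp
    finally show ?thesis
      using E by (simp add: zero_le_mult_iff)
  qed
  show "Re (cis (- (pi / 2)) * det (\<chi> i j. ?D (axis j 1) $ i)) =
      sqrt (det (\<chi> i j. ?D (axis i 1) \<bullet> ?D (axis j 1)))"
    unfolding Re_det gram zero using s by simp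
qed

section \<open>Absence of a splitting\<close>

lemma warren_second_difference_zero:
  assumes "\<And>p. warren (p + v + w) - warren (p + v) - warren (p + w) + warren p = 0"
    and "v $ 3 \<noteq> 0"
  shows "w = 0"
proof -
  define V W where "V = exp (v $ 3)" and "W = exp (w $ 3)"
  have V: "V \<noteq> 1" using assms(2) by (simp add: V_def)
  \<comment> \<open>On the plane t = 0 the mixed difference is a quadratic polynomial in
    \<open>a\<close> and \<open>b\<close>; differences at -1, 0, 1 extract its coefficients.\<close>
  let ?S = "\<lambda>a b. warren (vector [a, b, 0] + v + w) - warren (vector [a, b, 0] + v) -
    warren (vector [a, b, 0] + w) + warren (vector [a, b, 0])"
  have S: "?S 1 0 + ?S (-1) 0 - 2 * ?S 0 0 = 0" "?S 1 0 - ?S (-1) 0 = 0" "?S 0 1 - ?S 0 (-1) = 0"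
    by (simp_all only: assms(1))
  have "?S 1 0 + ?S (-1) 0 - 2 * ?S 0 0 = 2 * (V - 1) * (W - 1)"
    by (simp add: warren_def V_def W_def exp_add exp_minus power2_eq_square algebra_simps)
  then have W: "w $ 3 = 0"
    using S V by (simp add: W_def)
  \<comment> \<open>With \<open>W = 1\<close> the quadratic part is gone, and the linear
    coefficients detect the remaining components of \<open>w\<close>.\<close>
  have "?S 1 0 - ?S (-1) 0 = 4 * w $ 1 * (V - 1)" "?S 0 1 - ?S 0 (-1) = 4 * w $ 2 * (V - 1)"
    by (simp_all add: W warren_def V_def exp_add exp_minus power2_eq_square algebra_simps)
  then have "w $ 1 = 0" "w $ 2 = 0"
    using S V by simp_all
  with W show ?thesis
    by (simp add: vec_eq_iff forall_3)
qed

lemma not_graphically_splits_warren: "\<not> graphically_splits warren"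
proof
  assume "graphically_splits warren"
  then obtain V W f g where VW: "subspace V" "subspace W" "V \<noteq> {0}" "W \<noteq> {0}"
    and sum: "{v + w |v w. v \<in> V \<and> w \<in> W} = UNIV"
    and fg: "\<And>v w. v \<in> V \<Longrightarrow> w \<in> W \<Longrightarrow> warren (v + w) = f v + g w"
    unfolding graphically_splits_def by blast
  have diff: "warren (p + v + w) - warren (p + v) - warren (p + w) + warren p = 0"
    if "v \<in> V" "w \<in> W" for p v w
  proof -
    \<comment> \<open>Splitting the base point as well makes all four values sums of
      \<open>f\<close> and \<open>g\<close> terms that cancel in pairs.\<close>
    obtain p1 p2 where p: "p = p1 + p2" "p1 \<in> V" "p2 \<in> W"
      using sum by blast
    have pvw: "p1 + v \<in> V" "p2 + w \<in> W"
      using VW p that by (simp_all add: subspace_add)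
    have "warren (p + v + w) = f (p1 + v) + g (p2 + w)" "warren (p + v) = f (p1 + v) + g p2"
      "warren (p + w) = f p1 + g (p2 + w)" "warren p = f p1 + g p2"
      using fg[OF pvw(1) pvw(2)] fg[OF pvw(1) p(3)] fg[OF p(2) pvw(2)] fg[OF p(2,3)]
      by (simp_all only: p(1) ac_simps)
    then show ?thesis
      by simp
  qed
  \<comment> \<open>Some summand contains a vector with nonzero t-component, which forces the other
    summand to vanish.\<close>
  have "axis 3 1 \<in> {v + w |v w. v \<in> V \<and> w \<in> W}"
    unfolding sum by simp
  then obtain v w where vw: "v \<in> V" "w \<in> W" "axis 3 1 = v + w"
    by blast
  have "v $ 3 + w $ 3 = 1"
    using vw(3) by (metis axis_nth vector_add_component)
  then consider "v $ 3 \<noteq> 0" | "w $ 3 \<noteq> 0"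
    by fastforce
  then show False
  proof cases
    case 1
    then have "W \<subseteq> {0}"
      using warren_second_difference_zero diff vw(1) by blast
    then show False
      using VW subspace_0 by blast
  next
    case 2
    \<comment> \<open>The mixed difference is symmetric in its two steps, so the roles of
      \<open>V\<close> and \<open>W\<close> can be exchanged.\<close>
    have "warren (p + w + v') - warren (p + w) - warren (p + v') + warren p = 0"
      if "v' \<in> V" for p v'
      using diff[OF that vw(2), of p] by (simp add: algebra_simps)
    then have "V \<subseteq> {0}"
      using warren_second_difference_zero 2 by blast
    then show False
      using VW subspace_0 by blast
  qed
qed

theorem theorem3:
  "\<exists>(u :: real^3 \<Rightarrow> real) (\<theta> :: real).
     smooth u \<and> - (3 / 2 * pi) < \<theta> \<and> \<theta> < 3 / 2 * pi \<and>
     special_lagrangian_immersion \<theta> (gradient_graph u) \<and>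
     special_lagrangian_equation \<theta> u \<and>
     \<not> graphically_splits u"
  by (rule exI[where x = warren], rule exI[where x = "pi / 2"])
    (use pi_gt_zero in \<open>simp add: smooth_warren special_lagrangian_immersion_warren
      special_lagrangian_equation_warren not_graphically_splits_warren\<close>)

end
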